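(* Let $n\ge1$ and let $C_n$ be the set of vertices of the $n$-cycle graph with the graph metric. Writing $q=e^{-t}$, $t\in(0,\infty)$, we have $$|tC_n|_{\mathrm{Rips}}=\sum_{\substack{r\mid n,\ r\text{ odd}\\ r\neq n}}\frac nr\,q^{\frac nr\cdot\frac{r-1}2}(1-q)+q^{\lfloor n/2\rfloor},$$ where the sum is over positive odd divisors $r$ of $n$ with $r\ne n$.
   Context: $C_n$ is equipped with the graph metric in which adjacent vertices are at distance $1$; equivalently, it is the set of $n$ equidistant points in a geodesic circle of total arclength $n$, so $d(i,j)=\min(|i-j|,n-|i-j|)$ for $i,j\in\{0,\ldots,n-1\}$. For a finite metric space $X$, the Rips magnitude function $|tX|_{\mathrm{Rips}}$ is the persistent magnitude function of the persistent homology of its Vietoris–Rips complex; equivalently, it is given for $t\in(0,\infty)$ by $|tX|_{\mathrm{Rips}}=\sum_{\emptyset\ne A\subseteq X}(-1)^{\#A-1}e^{-\mathrm{diam}(A)t}$. *)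

theory Defs
  imports "HOL-Analysis.Analysis"
begin

text \<open>
  Finite metric spaces are given by a carrier \<open>X\<close> and a distance function \<open>d\<close>
  (cf. the locale \<^locale>\<open>Metric_space\<close>), since the number of points of the cycle is a variable.
  \<open>set_diam\<close> is only meant for finite nonempty \<open>A\<close>.
\<close>

definition set_diam :: "('a \<Rightarrow> 'a \<Rightarrow> real) \<Rightarrow> 'a set \<Rightarrow> real" where
  "set_diam d A = Max {d x y | x y. x \<in> A \<and> y \<in> A}"

text \<open>
  The Rips magnitude function of a finite metric space \<open>X\<close>, evaluated at \<open>t\<close>, by its
  simplexwise formula: the nonempty \<open>A \<subseteq> X\<close> are the simplices of the Vietoris--Rips filtration,
  \<open>A\<close> has dimension \<open>card A - 1\<close> and enters at filtration value \<open>diam A\<close>.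
\<close>

definition rips_magnitude :: "'a set \<Rightarrow> ('a \<Rightarrow> 'a \<Rightarrow> real) \<Rightarrow> real \<Rightarrow> real" where
  "rips_magnitude X d t =
     (\<Sum>A | A \<subseteq> X \<and> A \<noteq> {}. (-1) ^ (card A - 1) * exp (- set_diam d A * t))"

definition graph_dist :: "('a \<times> 'a) set \<Rightarrow> 'a \<Rightarrow> 'a \<Rightarrow> real" where
  "graph_dist E x y = real (LEAST k. (x, y) \<in> E ^^ k)"

definition cycle_vertices :: "nat \<Rightarrow> nat set" where
  "cycle_vertices n = {0..<n}"

text \<open>For \<open>n = 1\<close> there is no edge and for \<open>n = 2\<close> a single (undirected) one.\<close>

definition cycle_edges :: "nat \<Rightarrow> (nat \<times> nat) set" where
  "cycle_edges n = {(i, j). i < n \<and> j < n \<and> i \<noteq> j \<and> (j = (i + 1) mod n \<or> i = (j + 1) mod n)}"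

definition cycle_dist :: "nat \<Rightarrow> nat \<Rightarrow> nat \<Rightarrow> real" where
  "cycle_dist n = graph_dist (cycle_edges n)"


lemma cycle_edges_iff:
  "(i, j) \<in> cycle_edges n \<longleftrightarrow>
     i < n \<and> j < n \<and> i \<noteq> j \<and> (j = i + 1 \<or> i = j + 1 \<or> i = 0 \<and> j = n - 1 \<or> j = 0 \<and> i = n - 1)"
  by (auto simp: cycle_edges_def mod_Suc split: if_splits)

lemma cycle_walk_lower:
  assumes "(i, j) \<in> cycle_edges n ^^ k" "i < n"
  shows "j < n \<and> min \<bar>int i - int j\<bar> (int n - \<bar>int i - int j\<bar>) \<le> int k"
  using assms(1)
proof (induction k arbitrary: j)
  case 0
  then show ?case using assms(2) by auto
next
  case (Suc k)
  then obtain y where y: "(i, y) \<in> cycle_edges n ^^ k" "(y, j) \<in> cycle_edges n" by auto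
  from Suc.IH[OF y(1)] y(2) assms(2) show ?case
    unfolding cycle_edges_iff by (auto simp: min_def abs_if split: if_splits)
qed

lemma cycle_walk_up:
  assumes "i + k < n"
  shows "(i, i + k) \<in> cycle_edges n ^^ k"
  using assms
proof (induction k)
  case (Suc k)
  then have "(i, i + k) \<in> cycle_edges n ^^ k" "(i + k, i + Suc k) \<in> cycle_edges n"
    by (auto simp: cycle_edges_iff)
  then show ?case by auto
qed simp

lemma cycle_walk_sym:
  assumes "(i, j) \<in> cycle_edges n ^^ k"
  shows "(j, i) \<in> cycle_edges n ^^ k"
  using assms
proof (induction k arbitrary: j)
  case (Suc k)
  then obtain y where y: "(i, y) \<in> cycle_edges n ^^ k" "(y, j) \<in> cycle_edges n" by auto
  then have "(j, y) \<in> cycle_edges n" by (auto simp: cycle_edges_def)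
  with Suc.IH[OF y(1)] show ?case by (metis relpow_Suc_I2)
qed simp

lemma cycle_dist_eq:
  assumes "i < n" "j < n"
  shows "cycle_dist n i j =
    min \<bar>real i - real j\<bar> (real n - \<bar>real i - real j\<bar>)"
proof -
  have *: "cycle_dist n i j = real (min (j - i) (n - (j - i)))
      \<and> cycle_dist n j i = real (min (j - i) (n - (j - i)))"
    if "i \<le> j" "j < n" for i j
  proof -
    have 1: "(i, j) \<in> cycle_edges n ^^ (j - i)"
      using cycle_walk_up[of i "j - i" n] that by simp
    have 2: "(i, j) \<in> cycle_edges n ^^ (n - (j - i))" if "i < j"
    proof -
      have a: "(i, 0) \<in> cycle_edges n ^^ i"
        using cycle_walk_sym[OF cycle_walk_up[of 0 i n]] \<open>i \<le> j\<close> \<open>j < n\<close> by simp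
      have b: "(0, n - 1) \<in> cycle_edges n ^^ 1"
        using that \<open>j < n\<close> by (auto simp: cycle_edges_iff)
      have c: "(n - 1, j) \<in> cycle_edges n ^^ (n - 1 - j)"
        using cycle_walk_sym[OF cycle_walk_up[of j "n - 1 - j" n]] \<open>j < n\<close> by simp
      have "(i, j) \<in> cycle_edges n ^^ (i + 1 + (n - 1 - j))"
        using a b c by (metis relcompI relpow_add)
      moreover have "i + 1 + (n - 1 - j) = n - (j - i)" using that \<open>j < n\<close> by simp
      ultimately show ?thesis by metis
    qed
    let ?m = "min (j - i) (n - (j - i))"
    have up: "(i, j) \<in> cycle_edges n ^^ ?m"
      using 1 2 that by (cases "i = j") (auto simp: min_def)
    have low: "?m \<le> k" if "(i, j) \<in> cycle_edges n ^^ k" for k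
      using cycle_walk_lower[OF that] \<open>i \<le> j\<close> \<open>j < n\<close>
      by (auto simp: min_def abs_if split: if_splits)
    have "(LEAST k. (i, j) \<in> cycle_edges n ^^ k) = ?m"
      using up low by (rule Least_equality)
    moreover have "(LEAST k. (j, i) \<in> cycle_edges n ^^ k) = ?m"
      using cycle_walk_sym[OF up] low[OF cycle_walk_sym] by (rule Least_equality)
    ultimately show ?thesis
      by (simp add: cycle_dist_def graph_dist_def)
  qed
  show ?thesis
    using *[of i j] *[of j i] assms
    by (cases "i \<le> j") (auto simp: of_nat_diff min_def)
qed

end

(*
  Writing q^d as q^N plus the sum of q^k - q^(k+1) over d <= k < N, with N = n div 2, reduces the
  claim to the Euler characteristic of the complex of vertex sets of diameter at most k < N.
  Put m = n - 2k. This Euler characteristic is m if n is an odd multiple of m, and 0 otherwise.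

  For a clique A call p in A "leading" if, walking backwards from p around the circle, one meets
  the antipode of a point of A no later than another point of A. A clique containing p stays a
  clique when p + 1 is added or removed exactly if p - k is not in A, and if p is leading, this
  toggling does not change the set of leading points p with p - k not in A. So it is a
  sign-reversing involution on all cliques having such a "free" point. In a clique without
  one, p leading implies that p - k is in A and leading again; hence A is a coset of the subgroup
  generated by k, and this subgroup must be the one generated by m.
*)

theory Submission
  imports Defs
begin

section \<open>Cliques as periodic sets of integers, and their leading points\<close>

text \<open>Subsets of the cycle are handled as \<open>n\<close>-periodic sets of integers, which avoids modular
  reductions: two points are too far apart iff their difference lies strictly between \<open>k\<close>
  and \<open>n - k\<close>, modulo \<open>n\<close>.\<close>

locale cyclic_window =
  fixes n k :: int
  assumes k_nonneg: "0 \<le> k" and k_small: "2 * k + 2 \<le> n"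
begin

definition clique :: "int set \<Rightarrow> bool" where
  "clique S \<longleftrightarrow> (\<forall>x. x + n \<in> S \<longleftrightarrow> x \<in> S) \<and> (\<forall>x d. x \<in> S \<and> k < d \<and> d < n - k \<longrightarrow> x + d \<notin> S)"

text \<open>The antipode of \<open>p + x\<close> lies at \<open>p + x - n / 2\<close>, which need not be an integer; this is the
  reason for the doubled inequality.\<close>

definition leading :: "int set \<Rightarrow> int \<Rightarrow> bool" where
  "leading S p \<longleftrightarrow> p \<in> S \<and>
     (\<exists>x. 0 \<le> x \<and> x \<le> k \<and> p + x \<in> S \<and> (\<forall>j\<ge>1. 2 * (j + x) \<le> n \<longrightarrow> p - j \<notin> S))"

definition free :: "int set \<Rightarrow> int set" where
  "free S = {p. leading S p \<and> p - k \<notin> S}"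

lemma clique_shift: "clique S \<Longrightarrow> x + n \<in> S \<longleftrightarrow> x \<in> S"
  by (simp add: clique_def)

lemma clique_apart: "clique S \<Longrightarrow> x \<in> S \<Longrightarrow> y \<in> S \<Longrightarrow> k < y - x \<Longrightarrow> y - x < n - k \<Longrightarrow> False"
  unfolding clique_def by (metis add.commute diff_add_cancel)

lemma clique_dvd:
  assumes "clique S" "n dvd x - y" shows "x \<in> S \<longleftrightarrow> y \<in> S"
proof -
  have step: "y + int j * n \<in> S \<longleftrightarrow> y \<in> S" for j y
  proof (induction j)
    case (Suc j)
    have "y + int (Suc j) * n = (y + int j * n) + n" by (simp add: algebra_simps)
    then show ?case using Suc clique_shift[OF assms(1)] by metis
  qed simp
  obtain c where c: "x - y = n * c" using assms(2) by (elim dvdE)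
  show ?thesis
  proof (cases "c \<ge> 0")
    case True
    then show ?thesis using step[of y "nat c"] c by (simp add: algebra_simps)
  next
    case False
    then have "y = x + int (nat (- c)) * n" using c by (simp add: algebra_simps)
    then show ?thesis using step[of x "nat (- c)"] by metis
  qed
qed

section \<open>Free points and their invariance under toggling\<close>

text \<open>\<open>S\<close> and \<open>S'\<close> may differ only at \<open>p + 1\<close> (modulo \<open>n\<close>), whose predecessor lies in both. The
  roles of \<open>S\<close> and \<open>S'\<close> are symmetric, so this yields equality of the free sets.\<close>

lemma free_mono:
  assumes S: "clique S" and S': "clique S'" and p: "p \<in> S" "p \<in> S'"
    and same: "\<And>x. \<not> n dvd x - (p + 1) \<Longrightarrow> x \<in> S \<longleftrightarrow> x \<in> S'"
  shows "free S \<subseteq> free S'"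
proof
  fix r assume "r \<in> free S"
  then obtain x where r: "r \<in> S" "r - k \<notin> S" and x: "0 \<le> x" "x \<le> k" "r + x \<in> S"
    and gap: "\<And>j. j \<ge> 1 \<Longrightarrow> 2 * (j + x) \<le> n \<Longrightarrow> r - j \<notin> S"
    by (auto simp: free_def leading_def)
  have pred: "y - 1 \<in> S \<and> y - 1 \<in> S'" if "n dvd y - (p + 1)" for y
  proof -
    have "n dvd (y - 1) - p" using that by (simp add: algebra_simps)
    then show ?thesis using clique_dvd[OF S] clique_dvd[OF S'] p by metis
  qed
  \<comment> \<open>A leading point has no predecessor in \<open>S\<close>: \<open>j = 1\<close>
    meets the doubled bound, since \<open>x \<le> k\<close> and \<open>2 * k + 2 \<le> n\<close>.
    The toggled point has one.\<close>
  have r': "\<not> n dvd r - (p + 1)"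
    using pred[of r] gap[of 1] x(2) k_small by auto
  then have rS': "r \<in> S'" using same r by blast
  \<comment> \<open>If \<open>r - k\<close> were the toggled point, its predecessor would lie
    \<open>k + 1\<close> before \<open>r\<close>, a forbidden difference in
    \<open>S'\<close>.\<close>
  have free': "r - k \<notin> S'"
  proof
    assume "r - k \<in> S'"
    then have "n dvd (r - k) - (p + 1)" using same r(2) by blast
    then have "r - k - 1 \<in> S'" using pred by blast
    then show False using clique_apart[OF S' _ rS'] k_small k_nonneg by force
  qed
  have "\<exists>x. 0 \<le> x \<and> x \<le> k \<and> r + x \<in> S' \<and> (\<forall>j\<ge>1. 2 * (j + x) \<le> n \<longrightarrow> r - j \<notin> S')"
  proof (cases "n dvd (r + x) - (p + 1)")
    case True
    \<comment> \<open>The witness \<open>r + x\<close> is the toggled point; its predecessor serves as well.\<close>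
    have "x \<noteq> 0" using True r' by auto
    have q: "r + x - 1 \<in> S'" "r + x - 1 \<in> S" using pred[OF True] by auto
    have "r - j \<notin> S'" if j: "j \<ge> 1" "2 * (j + (x - 1)) \<le> n" for j
    proof
      assume a: "r - j \<in> S'"
      \<comment> \<open>The doubled bound keeps the difference at most n/2, below
        \<open>n - k\<close>, so in a clique it is at most \<open>k\<close>. Then
        \<open>2 * (j + x) \<le> 2 * k + 2 \<le> n\<close>, and the gap of the old witness covers
        \<open>j\<close>.\<close>
      have le: "j + x - 1 \<le> k"
        using clique_apart[OF S' a q(1)] j k_small by force
      then have "r - j \<notin> S" using gap[of j] j k_small by auto
      then have "n dvd (r - j) - (p + 1)" using a same by blast
      then have "n dvd ((r + x) - (p + 1)) - ((r - j) - (p + 1))" using True dvd_diff by blast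
      then have "n dvd x + j" by (simp add: algebra_simps)
      then have "n \<le> x + j" using zdvd_imp_le x j by auto
      then show False using le k_small k_nonneg by auto
    qed
    then show ?thesis using \<open>x \<noteq> 0\<close> x q by (intro exI[of _ "x - 1"]) (auto simp: algebra_simps)
  next
    case False
    then have xS': "r + x \<in> S'" using same x by blast
    have "r - j \<notin> S'" if j: "j \<ge> 1" "2 * (j + x) \<le> n" for j
    proof
      assume a: "r - j \<in> S'"
      then have "n dvd (r - j) - (p + 1)" using same gap j by blast
      then have b: "r - j - 1 \<in> S" using pred by blast
      \<comment> \<open>Again \<open>2 * (j + 1 + x) \<le> n\<close> follows, so the gap also covers
        the predecessor of the toggled point, which lies in \<open>S\<close>.\<close>
      have le: "j + x \<le> k"
        using clique_apart[OF S' a xS'] j k_small by force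
      then show False using gap[of "j + 1"] b j k_small by (auto simp: algebra_simps)
    qed
    then show ?thesis using x xS' by blast
  qed
  then show "r \<in> free S'" using rS' free' by (simp add: free_def leading_def)
qed

text \<open>The points too far from \<open>p + 1\<close> are \<open>p + k + 2\<close> to
  \<open>p + n - k\<close> modulo \<open>n\<close>. All but the last are also too far from
  \<open>p\<close>, and the last is \<open>p - k\<close>. So for \<open>p\<close> in the clique,
  \<open>p - k\<close> is the only possible obstruction to \<open>p + 1\<close>.\<close>

lemma clique_toggle:
  assumes S: "clique S" and p: "p \<in> S" "p - k \<notin> S"
    and S': "\<And>x. x \<in> S' \<longleftrightarrow> (x \<in> S \<longleftrightarrow> \<not> n dvd x - (p + 1))"
  shows "clique S'"
  unfolding clique_def
proof (intro conjI allI impI notI)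
  fix x
  have "n dvd (x + n) - (p + 1) \<longleftrightarrow> n dvd x - (p + 1)"
    by (metis add_diff_eq add.commute dvd_add_triv_left_iff)
  then show "x + n \<in> S' \<longleftrightarrow> x \<in> S'" using S' clique_shift[OF S] by metis
next
  have new: False if y: "n dvd y - (p + 1)" and z: "z \<in> S" "k < z - y" "z - y < n - k" for y z
  proof -
    have "n dvd (y - 1) - p" using y by (simp add: algebra_simps)
    then have y1: "y - 1 \<in> S" using clique_dvd[OF S] p by metis
    then have "z - (y - 1) \<ge> n - k" using clique_apart[OF S y1 z(1)] z by force
    then have "z - (y - 1) = n - k" using z by simp
    then have "z - (p - k) = (y - (p + 1)) + n" by simp
    moreover have "n dvd (y - (p + 1)) + n" using y by simp
    ultimately have "n dvd z - (p - k)" by metis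
    then show False using clique_dvd[OF S] p z by metis
  qed
  fix x d assume a: "x \<in> S' \<and> k < d \<and> d < n - k" "x + d \<in> S'"
  show False
  proof (cases "x \<in> S \<and> x + d \<in> S")
    case True
    then show False using a clique_apart[OF S, of x "x + d"] by auto
  next
    case False
    have "\<not> (n dvd x - (p + 1) \<and> n dvd x + d - (p + 1))"
    proof
      assume "n dvd x - (p + 1) \<and> n dvd x + d - (p + 1)"
      then have "n dvd (x + d - (p + 1)) - (x - (p + 1))" using dvd_diff by blast
      then have "n dvd d" by simp
      then show False using a zdvd_imp_le[of n d] k_nonneg by auto
    qed
    then consider "n dvd x - (p + 1)" "x + d \<in> S" | "n dvd x + d - (p + 1)" "x \<in> S"
      using False a S' by blast
    then show False
    proof cases
      case 1
      then show False using new[of x "x + d"] a by auto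
    next
      case 2
      \<comment> \<open>The forbidden range is symmetric under \<open>d\<close> to
        \<open>n - d\<close>, so going on around the circle turns the toggled endpoint into the left
        one.\<close>
      have "x + n \<in> S" using 2 clique_shift[OF S] by blast
      then show False using new[of "x + d" "x + n"] a 2 by auto
    qed
  qed
qed

text \<open>As \<open>p\<close> survives the toggle, \<open>free_mono\<close> applies in both
  directions. Equal free sets allow the same \<open>p\<close> to be chosen before and after, and
  \<open>p\<close> in \<open>S'\<close> keeps the result nonempty.\<close>

lemma free_toggle:
  assumes S: "clique S" and p: "p \<in> free S"
    and S': "\<And>x. x \<in> S' \<longleftrightarrow> (x \<in> S \<longleftrightarrow> \<not> n dvd x - (p + 1))"
  shows "clique S'" "free S' = free S" "p \<in> S'"
proof -
  have p0: "p \<in> S" "p - k \<notin> S" using p by (auto simp: free_def leading_def)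
  show c: "clique S'" using clique_toggle[OF S p0 S'] .
  have "\<not> n dvd p - (p + 1)" using k_small k_nonneg by (auto simp: zdvd1_eq)
  then show p': "p \<in> S'" using S' p0 by blast
  show "free S' = free S"
    using free_mono[OF c S p' p0(1)] free_mono[OF S c p0(1) p'] S' by blast
qed

section \<open>Cliques without free points\<close>

lemma leading_exists:
  assumes S: "clique S" and y: "y \<in> S"
  obtains p where "leading S p"
proof -
  define X where "X = {x \<in> {0..k}. y - x \<in> S}"
  have "finite X" by (rule finite_subset[of _ "{0..k}"]) (auto simp: X_def)
  moreover have "0 \<in> X" using y k_nonneg by (auto simp: X_def)
  ultimately have X: "finite X" "0 \<in> X" by blast+
  \<comment> \<open>The element of \<open>S\<close> farthest to the left of \<open>y\<close> within the window is leading.\<close>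
  define x where "x = Max X"
  have "x \<in> X" using X Max_in unfolding x_def by blast
  then have x: "0 \<le> x" "x \<le> k" "y - x \<in> S" by (auto simp: X_def)
  have "y - x - j \<notin> S" if j: "j \<ge> 1" "2 * (j + x) \<le> n" for j
  proof
    assume a: "y - x - j \<in> S"
    have "j + x \<le> k" using clique_apart[OF S a y] j k_small by force
    then have "j + x \<in> X" using a x j by (auto simp: X_def algebra_simps)
    then have "j + x \<le> x" using Max_ge[OF X(1)] unfolding x_def by blast
    then show False using j by simp
  qed
  then have "leading S (y - x)" unfolding leading_def using x y by auto
  then show ?thesis by (rule that)
qed

text \<open>The witness is \<open>p\<close> itself, with \<open>x = k\<close>: a point
  \<open>j\<close> before \<open>p - k\<close> lies \<open>j + k > k\<close> before
  \<open>p\<close>, and the doubled bound keeps this below \<open>n - k\<close>.\<close>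

lemma leading_back:
  assumes S: "clique S" and p: "p \<in> S" "p - k \<in> S"
  shows "leading S (p - k)"
proof -
  have "p - k - j \<notin> S" if j: "j \<ge> 1" "2 * (j + k) \<le> n" for j
    using clique_apart[OF S _ p(1), of "p - k - j"] j k_small by force
  then show ?thesis unfolding leading_def using p k_nonneg by (intro conjI exI[of _ k]) auto
qed

lemma free_empty_progression:
  assumes S: "clique S" "S \<noteq> {}" and free: "free S = {}"
  shows "(n - 2 * k) dvd k" "\<exists>c. S = {x. (n - 2 * k) dvd x - c}"
proof -
  obtain p where p: "leading S p" using leading_exists S by blast
  have walk: "leading S (p - int i * k)" for i
  proof (induction i)
    case (Suc i)
    then have "p - int i * k \<in> S" "p - int i * k - k \<in> S"
      using free by (auto simp: free_def leading_def)
    then have "leading S (p - int i * k - k)" using leading_back[OF S(1)] by blast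
    moreover have "p - int i * k - k = p - int (Suc i) * k" by (simp add: algebra_simps)
    ultimately show ?case by metis
  qed (use p in simp)
  have n0: "n > 0" using k_small k_nonneg by simp
  define g where "g = gcd k n"
  have grid: "y \<in> S" if y: "g dvd y - p" for y
  proof -
    obtain a b where "a * k + b * n = g" unfolding g_def using bezout_int by blast
    moreover obtain c where "y - p = g * c" using y by (elim dvdE)
    ultimately have yp: "y - p = a * c * k + b * c * n" by (auto simp: algebra_simps)
    \<comment> \<open>The walk only goes backwards, so the Bezout coefficient of \<open>k\<close> is
      negated and reduced modulo \<open>n\<close> to a natural number of steps.\<close>
    define i where "i = nat ((- (a * c)) mod n)"
    have i: "int i = (- (a * c)) mod n" using n0 by (simp add: i_def)
    have "n dvd int i + a * c" unfolding i by (metis add.commute add.right_inverse dvd_eq_mod_eq_0 mod_0 mod_add_right_eq)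
    then have "n dvd (int i + a * c) * k + b * c * n" by simp
    then have "n dvd y - (p - int i * k)" using yp by (simp add: algebra_simps)
    then show ?thesis using walk[of i] clique_dvd[OF S(1)] by (auto simp: leading_def)
  qed
  define m where "m = n - 2 * k"
  have m: "m > 0" using k_small by (simp add: m_def)
  have "g dvd k" "g dvd n" by (simp_all add: g_def)
  then have gm: "g dvd m" by (simp add: m_def)
  have gpos: "g > 0" using n0 by (simp add: g_def)
  \<comment> \<open>The grid point \<open>p + k + g\<close> is more than \<open>k\<close> ahead of
    \<open>p\<close>, hence at least \<open>n - k\<close> ahead, so \<open>g \<ge> m\<close>.
    Together with \<open>g dvd m\<close> this determines \<open>g\<close>.\<close>
  have "g dvd (p + k + g) - p" "p \<in> S" using \<open>g dvd k\<close> p by (simp_all add: leading_def add.assoc)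
  then have "k + g \<ge> n - k"
    using clique_apart[OF S(1), of p "p + k + g"] grid gpos by force
  then have gm': "g = m" using zdvd_imp_le[OF gm m] by (simp add: m_def)
  show mk: "(n - 2 * k) dvd k" using \<open>g dvd k\<close> gm' m_def by simp
  have "m dvd y - p" if y: "y \<in> S" for y
  proof (rule ccontr)
    assume nd: "\<not> m dvd y - p"
    \<comment> \<open>For \<open>y\<close> off the grid, \<open>y + k + (m - s)\<close> is on it,
      and its lead over \<open>y\<close> lies strictly between \<open>k\<close> and
      \<open>k + m = n - k\<close>.\<close>
    define s where "s = (y - p) mod m"
    have "s \<noteq> 0" using nd by (simp add: s_def dvd_eq_mod_eq_0)
    then have s: "0 < s" "s < m"
      using pos_mod_sign[OF m, of "y - p"] pos_mod_bound[OF m, of "y - p"] by (simp_all add: s_def)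
    have "m dvd (y - p) - s" unfolding s_def by (simp add: minus_mod_eq_mult_div)
    moreover have "m dvd k + m" using mk unfolding m_def[symmetric] by simp
    ultimately have "m dvd (y - p) - s + (k + m)" using dvd_add by blast
    then have "m dvd (y + k + (m - s)) - p" by (simp add: algebra_simps)
    then have "y + k + (m - s) \<in> S" using grid gm' by blast
    then show False using clique_apart[OF S(1) y] s by (force simp: m_def)
  qed
  then have "S = {x. (n - 2 * k) dvd x - p}" using grid gm' by (auto simp: m_def)
  then show "\<exists>c. S = {x. (n - 2 * k) dvd x - c}" ..
qed

text \<open>Two points of the class at a forbidden difference \<open>d\<close> would make
  \<open>d - k\<close> a multiple of \<open>n - 2 * k\<close> strictly between 0 and
  \<open>n - 2 * k\<close>. No point is free, since subtracting \<open>k\<close> stays in the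
  class.\<close>

lemma clique_progression:
  assumes mk: "(n - 2 * k) dvd k"
  shows "clique {x. (n - 2 * k) dvd x - c}" "free {x. (n - 2 * k) dvd x - c} = {}"
proof -
  define m where "m = n - 2 * k"
  have m: "m > 0" "m dvd k" using k_small mk by (simp_all add: m_def)
  have "m dvd 2 * k + m" using m by simp
  then have mn: "m dvd n" by (simp add: m_def)
  have shift: "m dvd x + n - c \<longleftrightarrow> m dvd x - c" for x
    using mn by (metis add_diff_eq add.commute dvd_add_right_iff diff_add_eq)
  have apart: False if "m dvd x - c" "m dvd x + d - c" "k < d" "d < n - k" for x d
  proof -
    have "m dvd (x + d - c) - (x - c)" using that dvd_diff by blast
    then have "m dvd d" by simp
    then have "m dvd d - k" using m by simp
    then have "m \<le> d - k" using zdvd_imp_le that by simp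
    then show False using that by (simp add: m_def)
  qed
  show "clique {x. (n - 2 * k) dvd x - c}"
    unfolding clique_def using shift apart by (auto simp: m_def)
  have "m dvd p - k - c" if "m dvd p - c" for p
  proof -
    have "m dvd (p - c) - k" using that m dvd_diff by blast
    then show ?thesis by (simp add: algebra_simps)
  qed
  then show "free {x. (n - 2 * k) dvd x - c} = {}"
    by (auto simp: free_def leading_def m_def)
qed

end

section \<open>Translation between vertex sets and periodic sets of integers\<close>

definition periodic_lift :: "nat \<Rightarrow> nat set \<Rightarrow> int set" where
  "periodic_lift n A = {x. nat (x mod int n) \<in> A}"

definition dist_le :: "nat \<Rightarrow> nat \<Rightarrow> nat set \<Rightarrow> bool" where
  "dist_le n k A \<longleftrightarrow> (\<forall>i\<in>A. \<forall>j\<in>A. cycle_dist n i j \<le> real k)"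

lemma periodic_lift_of_nat: "i < n \<Longrightarrow> int i \<in> periodic_lift n A \<longleftrightarrow> i \<in> A"
  by (simp add: periodic_lift_def)

lemma clique_periodic_lift_iff:
  assumes w: "2 * k + 2 \<le> n" and A: "A \<subseteq> {0..<n}"
  shows "cyclic_window.clique (int n) (int k) (periodic_lift n A) \<longleftrightarrow> dist_le n k A"
proof -
  interpret cyclic_window "int n" "int k" by unfold_locales (use w in auto)
  have n0: "int n > 0" using w by simp
  show ?thesis
  proof
    assume c: "clique (periodic_lift n A)"
    show "dist_le n k A"
      unfolding dist_le_def
    proof (intro ballI)
      fix i j assume ij: "i \<in> A" "j \<in> A"
      then have lt: "i < n" "j < n" using A by auto
      have m: "int i \<in> periodic_lift n A" "int j \<in> periodic_lift n A"
        using ij lt by (auto simp: periodic_lift_of_nat)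
      have "\<not> (int k < int j - int i \<and> int j - int i < int n - int k)"
        "\<not> (int k < int i - int j \<and> int i - int j < int n - int k)"
        using clique_apart[OF c] m by blast+
      then show "cycle_dist n i j \<le> real k"
        unfolding cycle_dist_eq[OF lt] by linarith
    qed
  next
    assume d: "dist_le n k A"
    show "clique (periodic_lift n A)"
      unfolding clique_def
    proof (intro conjI allI impI notI)
      fix x show "x + int n \<in> periodic_lift n A \<longleftrightarrow> x \<in> periodic_lift n A"
        by (simp add: periodic_lift_def)
    next
      fix x e assume a: "x \<in> periodic_lift n A \<and> int k < e \<and> e < int n - int k"
        "x + e \<in> periodic_lift n A"
      define i j where "i = nat (x mod int n)" and "j = nat ((x + e) mod int n)"
      have ij: "i \<in> A" "j \<in> A" using a by (auto simp: i_def j_def periodic_lift_def)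
      then have lt: "i < n" "j < n" using A by auto
      have i: "int i = x mod int n" and j: "int j = (x + e) mod int n"
        using n0 by (simp_all add: i_def j_def)
      \<comment> \<open>At most one reduction by \<open>n\<close> occurs, so the two residues differ
        by \<open>e\<close> or \<open>n - e\<close>, and both exceed \<open>k\<close>.\<close>
      have "int j = (int i + e) mod int n" unfolding i j by (simp add: mod_simps)
      also have "\<dots> = (if int i + e < int n then int i + e else int i + e - int n)"
      proof (cases "int i + e < int n")
        case False
        have "(int i + e) mod int n = (int i + e - int n) mod int n" by simp
        also have "\<dots> = int i + e - int n" using False lt a by (intro mod_pos_pos_trivial) auto
        finally show ?thesis using False by simp
      qed (use a in simp)
      finally have "int j = int i + e \<or> int j = int i + e - int n" by presburger
      moreover have "cycle_dist n i j \<le> real k" using d ij by (auto simp: dist_le_def)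
      ultimately show False
        using a unfolding cycle_dist_eq[OF lt] by linarith
    qed
  qed
qed

section \<open>Euler characteristic of the clique complex at a fixed scale\<close>

lemma card_residue_class:
  fixes m n c :: nat
  assumes "m dvd n" "c < m"
  shows "card {x\<in>{0..<n}. x mod m = c} = n div m"
proof -
  obtain b where b: "n = m * b" using assms by (elim dvdE)
  have "bij_betw (\<lambda>j. c + m * j) {..<b} {x\<in>{0..<n}. x mod m = c}"
  proof (rule bij_betw_byWitness[where f' = "\<lambda>x. x div m"])
    have "c + m * j < m * b" if "j < b" for j
    proof -
      have "c + m * j < m * Suc j" using assms by simp
      also have "\<dots> \<le> m * b" using that by (intro mult_le_mono2) simp
      finally show ?thesis .
    qed
    then show "(\<lambda>j. c + m * j) ` {..<b} \<subseteq> {x\<in>{0..<n}. x mod m = c}"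
      using assms b by auto
    show "(\<lambda>x. x div m) ` {x\<in>{0..<n}. x mod m = c} \<subseteq> {..<b}"
      using b by (auto simp: less_mult_imp_div_less mult.commute)
  qed (use assms in auto)
  then show ?thesis using bij_betw_same_card[of _ "{..<b}"] b assms by fastforce
qed

lemma sum_sign_involution:
  fixes s :: "'a \<Rightarrow> real"
  assumes "\<And>A. A \<in> E \<Longrightarrow> f A \<in> E" "\<And>A. A \<in> E \<Longrightarrow> f (f A) = A" "\<And>A. A \<in> E \<Longrightarrow> s (f A) = - s A"
  shows "sum s E = 0"
proof -
  have "sum s E = sum (\<lambda>A. - s A) E"
    by (rule sum.reindex_bij_witness[where i = f and j = f]) (use assms in auto)
  then show ?thesis by (simp add: sum_negf)
qed

definition toggle :: "'a \<Rightarrow> 'a set \<Rightarrow> 'a set" where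
  "toggle v A = (if v \<in> A then A - {v} else insert v A)"

lemma toggle_toggle [simp]: "toggle v (toggle v A) = A"
  by (auto simp: toggle_def)

text \<open>Nonemptiness matters on both sides: by truncated subtraction the empty set and a
  singleton would both get sign 1.\<close>

lemma sign_toggle:
  assumes "finite A" "A \<noteq> {}" "toggle v A \<noteq> {}"
  shows "(-1) ^ (card (toggle v A) - 1) = - ((-1) ^ (card A - 1) :: real)"
proof -
  have "card A > 0" "card (toggle v A) > 0"
    "card (toggle v A) = Suc (card A) \<or> card A = Suc (card (toggle v A))"
    using assms by (auto simp: toggle_def card_gt_0_iff card_Suc_Diff1 split: if_splits)
  then show ?thesis by (cases "card A"; cases "card (toggle v A)") auto
qed

text \<open>With \<open>m = n - 2 * k\<close>, the condition on the right says that \<open>m\<close>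
  divides \<open>k\<close>. In that case the cliques left uncancelled are the \<open>m\<close>
  residue classes modulo \<open>m\<close>, each of odd size \<open>n div m\<close> and so of sign
  1.\<close>

lemma euler_char_cliques:
  fixes n k :: nat
  assumes w: "2 * k + 2 \<le> n"
  shows "(\<Sum>A | A \<subseteq> {0..<n} \<and> A \<noteq> {} \<and> dist_le n k A. (-1) ^ (card A - 1)) =
    (if (n - 2 * k) dvd n \<and> odd (n div (n - 2 * k)) then real (n - 2 * k) else 0)"
proof -
  interpret cyclic_window "int n" "int k" by unfold_locales (use w in auto)
  let ?L = "periodic_lift n"
  define s :: "nat set \<Rightarrow> real" where "s A = (-1) ^ (card A - 1)" for A
  define C where "C = {A. A \<subseteq> {0..<n} \<and> A \<noteq> {} \<and> dist_le n k A}"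
  define E where "E = {A\<in>C. free (?L A) \<noteq> {}}"
  define m where "m = n - 2 * k"
  have m: "m > 0" "int m = int n - 2 * int k" using w by (auto simp: m_def)
  have finC: "finite C" by (rule finite_subset[of _ "Pow {0..<n}"]) (auto simp: C_def)
  have lift: "clique (?L A)" if "A \<in> C" for A
    using that clique_periodic_lift_iff[OF w] by (auto simp: C_def)
  have nonempty: "?L A \<noteq> {}" if A: "A \<in> C" for A
  proof -
    obtain i where "i \<in> A" "i < n" using A by (force simp: C_def)
    then show ?thesis using periodic_lift_of_nat by blast
  qed
  \<comment> \<open>The choice depends on \<open>A\<close> only through its free set, which toggling
    preserves, so applying \<open>f\<close> twice toggles the same vertex.\<close>
  define p where "p A = (SOME x. x \<in> free (?L A))" for A
  define v where "v A = nat ((p A + 1) mod int n)" for A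
  define f where "f A = toggle (v A) A" for A
  have vlt: "v A < n" for A using w by (simp add: v_def nat_less_iff)
  have fE: "f A \<in> E \<and> free (?L (f A)) = free (?L A)" if A: "A \<in> E" for A
  proof -
    have c: "clique (?L A)" and p: "p A \<in> free (?L A)"
      using A lift by (auto simp: E_def p_def some_in_eq)
    have "x \<in> ?L (f A) \<longleftrightarrow> (x \<in> ?L A \<longleftrightarrow> \<not> int n dvd x - (p A + 1))" for x
    proof -
      have "int n dvd x - (p A + 1) \<longleftrightarrow> x mod int n = (p A + 1) mod int n"
        by (simp add: mod_eq_dvd_iff)
      also have "\<dots> \<longleftrightarrow> nat (x mod int n) = v A"
        unfolding v_def using w by (subst nat_eq_iff2) auto
      finally show ?thesis by (auto simp: periodic_lift_def f_def toggle_def)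
    qed
    note t = free_toggle[OF c p this]
    have "f A \<subseteq> {0..<n}" using A vlt by (auto simp: E_def C_def f_def toggle_def split: if_splits)
    moreover have "f A \<noteq> {}" using t(3) by (auto simp: periodic_lift_def)
    ultimately have "f A \<in> C" using t(1) clique_periodic_lift_iff[OF w] by (auto simp: C_def)
    then show ?thesis using t(2) A by (auto simp: E_def)
  qed
  have "sum s E = 0"
  proof (rule sum_sign_involution[where f = f])
    fix A assume A: "A \<in> E"
    show "f A \<in> E" using fE[OF A] by blast
    have "v (f A) = v A" using fE[OF A] by (simp add: v_def p_def)
    then show "f (f A) = A" unfolding f_def[of "f A"] by (simp add: f_def)
    have "finite A" "A \<noteq> {}" "f A \<noteq> {}" using A fE[OF A] finite_subset by (auto simp: E_def C_def)
    then show "s (f A) = - s A" unfolding s_def f_def by (intro sign_toggle)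
  qed
  moreover have "sum s C = sum s E + sum s (C - E)"
    using finC by (subst sum.subset_diff[of E]) (auto simp: E_def)
  moreover have "sum s (C - E) = (if m dvd n \<and> odd (n div m) then real m else 0)"
  proof -
    have dvd_iff: "int m dvd int k \<longleftrightarrow> m dvd n \<and> odd (n div m)"
    proof -
      have n: "n = 2 * k + m" using w by (simp add: m_def)
      show ?thesis
      proof
        assume "int m dvd int k"
        then obtain l where "k = m * l" by auto
        then have "n = m * (2 * l + 1)" using n by simp
        then show "m dvd n \<and> odd (n div m)" using m by simp
      next
        assume a: "m dvd n \<and> odd (n div m)"
        then obtain l where "n div m = 2 * l + 1" by (auto elim: oddE)
        then have "n = m * (2 * l + 1)" using a by (metis dvd_mult_div_cancel)
        then have "k = m * l" using n by (simp add: algebra_simps)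
        then show "int m dvd int k" by simp
      qed
    qed
    define R where "R c = {x\<in>{0..<n}. x mod m = c}" for c
    have R: "?L (R c) = {x. int m dvd x - int c}" if "m dvd n" "c < m" for c
    proof -
      have "nat (x mod int n) mod m = c \<longleftrightarrow> int m dvd x - int c" for x
      proof -
        have "int (nat (x mod int n) mod m) = (x mod int n) mod int m"
          using w by (simp add: of_nat_mod)
        then have "nat (x mod int n) mod m = c \<longleftrightarrow> (x mod int n) mod int m = int c"
          by (metis of_nat_eq_iff)
        also have "\<dots> \<longleftrightarrow> x mod int m = int c mod int m"
          using that by (simp add: mod_mod_cancel)
        finally show ?thesis by (simp add: mod_eq_dvd_iff)
      qed
      moreover have "nat (x mod int n) < n" for x using w by (simp add: nat_less_iff)
      ultimately show ?thesis by (auto simp: periodic_lift_def R_def)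
    qed
    show ?thesis
    proof (cases "int m dvd int k")
      case False
      have "A \<in> E" if "A \<in> C" for A
      proof (rule ccontr)
        assume "A \<notin> E"
        then have "free (?L A) = {}" using that by (simp add: E_def)
        then have "int m dvd int k"
          using free_empty_progression(1)[OF lift[OF that] nonempty[OF that]] m by simp
        then show False using False by simp
      qed
      then have "C - E = {}" by blast
      then have "sum s (C - E) = 0" by (simp only: sum.empty)
      then show ?thesis using False unfolding dvd_iff by (simp only: if_False)
    next
      case True
      then have mn: "m dvd n" "odd (n div m)" using dvd_iff by auto
      have cardR: "card (R c) = n div m" if "c < m" for c
        using card_residue_class[OF mn(1) that] by (simp add: R_def)
      have "R c \<in> C - E" if "c < m" for c
      proof -
        have "clique (?L (R c))" "free (?L (R c)) = {}"
          using clique_progression[of "int c"] True m R[OF mn(1) that] by auto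
        moreover have "R c \<noteq> {}" using cardR[OF that] mn by auto
        moreover have "R c \<subseteq> {0..<n}" by (auto simp: R_def)
        ultimately show ?thesis
          using clique_periodic_lift_iff[OF w, of "R c"] by (simp add: E_def C_def)
      qed
      moreover have "A \<in> R ` {..<m}" if A: "A \<in> C - E" for A
      proof -
        have A0: "A \<subseteq> {0..<n}" "A \<in> C" "free (?L A) = {}" using A by (auto simp: C_def E_def)
        obtain c where c: "?L A = {x. int m dvd x - c}"
          using free_empty_progression(2)[OF lift[OF A0(2)] nonempty[OF A0(2)] A0(3)] m by auto
        define c' where "c' = nat (c mod int m)"
        have c': "c' < m" "int c' = c mod int m" using m by (auto simp: c'_def nat_less_iff)
        have "int m dvd x - c \<longleftrightarrow> int m dvd x - int c'" for x
          unfolding mod_eq_dvd_iff[symmetric] c'(2) by simp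
        then have "?L A = ?L (R c')" using c R[OF mn(1) c'(1)] by simp
        then have "i \<in> A \<longleftrightarrow> i \<in> R c'" if "i < n" for i
          using periodic_lift_of_nat[OF that] by metis
        then have "A = R c'" using A0(1) by (auto simp: R_def)
        then show ?thesis using c' by blast
      qed
      ultimately have "C - E = R ` {..<m}" by auto
      moreover have "inj_on R {..<m}"
      proof (rule inj_onI)
        fix a b assume ab: "a \<in> {..<m}" "b \<in> {..<m}" "R a = R b"
        have "m \<le> n" by (simp add: m_def)
        then have "a \<in> R a" using ab(1) by (auto simp: R_def)
        then have "a \<in> R b" unfolding ab(3) .
        then show "a = b" using ab(1) by (auto simp: R_def)
      qed
      ultimately have "sum s (C - E) = (\<Sum>c<m. s (R c))" by (simp add: sum.reindex)
      also have "\<dots> = (\<Sum>c<m. 1)"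
        using cardR mn by (intro sum.cong) (auto simp: s_def elim!: oddE)
      finally show ?thesis using mn by simp
    qed
  qed
  ultimately show ?thesis by (simp add: C_def s_def m_def)
qed

section \<open>Summation over all scales\<close>

text \<open>Toggling a fixed point \<open>a\<close> pairs off all nonempty subsets except
  \<open>{a}\<close>, whose partner would be the empty set.\<close>

lemma sum_sign_nonempty_subsets:
  assumes "finite X" "X \<noteq> {}"
  shows "(\<Sum>A | A \<subseteq> X \<and> A \<noteq> {}. (-1) ^ (card A - 1)) = (1::real)"
proof -
  obtain a where a: "a \<in> X" using assms by blast
  let ?s = "\<lambda>A. (-1) ^ (card A - 1) :: real"
  have fin: "finite {A. A \<subseteq> X \<and> A \<noteq> {}}" using assms by simp
  have "sum ?s ({A. A \<subseteq> X \<and> A \<noteq> {}} - {{a}}) = 0"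
  proof (rule sum_sign_involution[where f = "toggle a"])
    fix A assume A: "A \<in> {A. A \<subseteq> X \<and> A \<noteq> {}} - {{a}}"
    then show *: "toggle a A \<in> {A. A \<subseteq> X \<and> A \<noteq> {}} - {{a}}"
      using a by (auto simp: toggle_def)
    show "toggle a (toggle a A) = A" by simp
    show "?s (toggle a A) = - ?s A"
      using A * finite_subset[OF _ assms(1)] by (intro sign_toggle) auto
  qed
  moreover have "sum ?s {A. A \<subseteq> X \<and> A \<noteq> {}} = ?s {a} + sum ?s ({A. A \<subseteq> X \<and> A \<noteq> {}} - {{a}})"
    using a by (intro sum.remove[OF fin]) auto
  ultimately show ?thesis by simp
qed

text \<open>The diameter is attained as a distance, hence a natural number. This turns the
  exponential into a power of \<open>q\<close> and makes integer scales suffice.\<close>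

lemma set_diam_cycle:
  assumes "A \<subseteq> {0..<n}" "A \<noteq> {}"
  obtains \<delta> where "\<delta> \<le> n div 2" "set_diam (cycle_dist n) A = real \<delta>"
    "\<And>k. dist_le n k A \<longleftrightarrow> \<delta> \<le> k"
proof -
  let ?D = "{cycle_dist n x y | x y. x \<in> A \<and> y \<in> A}"
  have D: "?D = (\<lambda>(x, y). cycle_dist n x y) ` (A \<times> A)" by auto
  have "finite A" using assms finite_subset by blast
  then have fin: "finite ?D" "?D \<noteq> {}" using assms D by auto
  have "Max ?D \<in> ?D" using Max_in[OF fin] .
  then obtain x y where xy: "x \<in> A" "y \<in> A" "Max ?D = cycle_dist n x y" by auto
  have lt: "x < n" "y < n" using xy assms by auto
  define \<delta> where "\<delta> = nat (min \<bar>int x - int y\<bar> (int n - \<bar>int x - int y\<bar>))"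
  have int_delta: "int \<delta> = min \<bar>int x - int y\<bar> (int n - \<bar>int x - int y\<bar>)"
    using lt unfolding \<delta>_def by (subst int_nat_eq) auto
  then have "real_of_int (int \<delta>) = real_of_int (min \<bar>int x - int y\<bar> (int n - \<bar>int x - int y\<bar>))"
    by metis
  then have "real \<delta> = cycle_dist n x y"
    unfolding cycle_dist_eq[OF lt] by (simp add: of_int_min)
  then have d: "set_diam (cycle_dist n) A = real \<delta>"
    using xy by (simp add: set_diam_def)
  have "2 * int \<delta> \<le> int n" unfolding int_delta by (simp add: min_def)
  then have "\<delta> \<le> n div 2" by linarith
  moreover have "dist_le n k A \<longleftrightarrow> \<delta> \<le> k" for k
  proof -
    have "dist_le n k A \<longleftrightarrow> (\<forall>z\<in>?D. z \<le> real k)" by (auto simp: dist_le_def)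
    also have "\<dots> \<longleftrightarrow> Max ?D \<le> real k" using fin by simp
    finally show ?thesis using d by (simp add: set_diam_def)
  qed
  ultimately show ?thesis using d that by blast
qed

text \<open>The range of \<open>k\<close> is kept independent of \<open>d\<close>, with a condition
  inside the sum, so that the sums over scales and over vertex sets can be swapped.\<close>

lemma power_telescope:
  fixes q :: real
  assumes "d \<le> N"
  shows "q ^ d = q ^ N + (\<Sum>k<N. if d \<le> k then q ^ k * (1 - q) else 0)"
  using assms
proof (induction N)
  case (Suc N)
  then show ?case
    by (cases "d = Suc N") (auto simp: algebra_simps intro!: sum.neutral)
qed simp

theorem proposition8p1:
  fixes n :: nat and t q :: real
  assumes "n \<ge> 1" and "t > 0" and "q = exp (- t)"
  shows "rips_magnitude (cycle_vertices n) (cycle_dist n) t =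
    (\<Sum>r | r dvd n \<and> odd r \<and> r \<noteq> n.
        real (n div r) * q ^ ((n div r) * ((r - 1) div 2)) * (1 - q))
    + q ^ (n div 2)"
proof -
  define N where "N = n div 2"
  define P where "P = {A. A \<subseteq> {0..<n} \<and> A \<noteq> {}}"
  define s :: "nat set \<Rightarrow> real" where "s A = (-1) ^ (card A - 1)" for A
  have finP: "finite P" by (simp add: P_def)
  have "exp (- set_diam (cycle_dist n) A * t) =
      q ^ N + (\<Sum>k<N. if dist_le n k A then q ^ k * (1 - q) else 0)" if "A \<in> P" for A
  proof -
    obtain \<delta> where \<delta>: "\<delta> \<le> N" "set_diam (cycle_dist n) A = real \<delta>" "\<And>k. dist_le n k A \<longleftrightarrow> \<delta> \<le> k"
      using set_diam_cycle \<open>A \<in> P\<close> unfolding P_def N_def by blast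
    have "exp (- set_diam (cycle_dist n) A * t) = q ^ \<delta>"
      using \<delta> assms(3) by (simp add: exp_of_nat_mult[symmetric])
    then show ?thesis using power_telescope[OF \<delta>(1)] \<delta>(3) by simp
  qed
  then have "rips_magnitude (cycle_vertices n) (cycle_dist n) t =
      (\<Sum>A\<in>P. s A * (q ^ N + (\<Sum>k<N. if dist_le n k A then q ^ k * (1 - q) else 0)))"
    unfolding rips_magnitude_def cycle_vertices_def P_def s_def by (intro sum.cong) auto
  also have "\<dots> = sum s P * q ^ N
      + (\<Sum>k<N. \<Sum>A\<in>P. s A * (if dist_le n k A then q ^ k * (1 - q) else 0))"
    by (subst sum.swap) (simp add: distrib_left sum.distrib sum_distrib_left sum_distrib_right)
  also have "sum s P = 1"
    using sum_sign_nonempty_subsets[of "{0..<n}"] assms(1) by (simp add: P_def s_def)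
  also have "(\<Sum>k<N. \<Sum>A\<in>P. s A * (if dist_le n k A then q ^ k * (1 - q) else 0)) =
      (\<Sum>k<N. if (n - 2 * k) dvd n \<and> odd (n div (n - 2 * k))
        then real (n - 2 * k) * q ^ k * (1 - q) else 0)"
  proof (rule sum.cong)
    fix k assume "k \<in> {..<N}"
    then have w: "2 * k + 2 \<le> n" by (auto simp: N_def)
    have "(\<Sum>A\<in>P. s A * (if dist_le n k A then q ^ k * (1 - q) else 0)) =
        (\<Sum>A | A \<in> P \<and> dist_le n k A. s A) * (q ^ k * (1 - q))"
      unfolding sum_distrib_right by (rule sum.mono_neutral_cong_right[OF finP]) auto
    also have "(\<Sum>A | A \<in> P \<and> dist_le n k A. s A) =
        (if (n - 2 * k) dvd n \<and> odd (n div (n - 2 * k)) then real (n - 2 * k) else 0)"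
      using euler_char_cliques[OF w] by (simp add: P_def s_def)
    finally show "(\<Sum>A\<in>P. s A * (if dist_le n k A then q ^ k * (1 - q) else 0)) =
        (if (n - 2 * k) dvd n \<and> odd (n div (n - 2 * k))
        then real (n - 2 * k) * q ^ k * (1 - q) else 0)" by (simp add: mult.assoc)
  qed simp
  also have "\<dots> = (\<Sum>k | k < N \<and> (n - 2 * k) dvd n \<and> odd (n div (n - 2 * k)).
      real (n - 2 * k) * q ^ k * (1 - q))"
    by (rule sum.mono_neutral_cong_right) auto
  also have "\<dots> = (\<Sum>r | r dvd n \<and> odd r \<and> r \<noteq> n.
        real (n div r) * q ^ ((n div r) * ((r - 1) div 2)) * (1 - q))"
  proof -
    \<comment> \<open>\<open>\<kappa> r\<close> solves \<open>n - 2 * k = n div r\<close> for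
      \<open>k\<close>: if \<open>n = r * b\<close> and \<open>r = 2 * l + 1\<close>, then
      \<open>n = 2 * (b * l) + b\<close>.\<close>
    define \<kappa> where "\<kappa> r = (n div r) * ((r - 1) div 2)" for r
    define \<rho> where "\<rho> k = n div (n - 2 * k)" for k
    have r: "n - 2 * \<kappa> r = n div r \<and> n div r dvd n \<and> \<kappa> r < N \<and> \<rho> (\<kappa> r) = r"
      if "r dvd n" "odd r" "r \<noteq> n" for r
    proof -
      obtain b l where bl: "n = r * b" "r = 2 * l + 1" using \<open>r dvd n\<close> \<open>odd r\<close> by (elim dvdE oddE)
      \<comment> \<open>Excluding \<open>r = n\<close> gives \<open>b \<ge> 2\<close>, which is what
        puts \<open>b * l\<close> strictly below \<open>N\<close>. Conversely, \<open>k < N\<close>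
        forces \<open>b \<ge> 2\<close> and thus \<open>\<rho> k \<noteq> n\<close>.\<close>
      have b: "b \<noteq> 0" "b \<noteq> 1" using bl \<open>r \<noteq> n\<close> assms(1) by (auto intro: ccontr)
      have "r > 0" using bl by simp
      then have "n div r = b" "n div b = r" using b unfolding bl(1) by simp_all
      moreover have "(r - 1) div 2 = l" using bl by simp
      ultimately have db: "n div r = b" "(r - 1) div 2 = l" "n div b = r" by blast+
      have n: "n = 2 * (b * l) + b" using bl by (simp add: algebra_simps)
      have "b * l < N" using n b unfolding N_def by linarith
      then show ?thesis using n bl db by (auto simp: \<kappa>_def \<rho>_def db)
    qed
    have k: "\<rho> k \<noteq> n \<and> \<rho> k dvd n \<and> odd (\<rho> k) \<and> \<kappa> (\<rho> k) = k \<and> n div \<rho> k = n - 2 * k"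
      if a: "k < N" "(n - 2 * k) dvd n" "odd (n div (n - 2 * k))" for k
    proof -
      define b where "b = n - 2 * k"
      have b: "b \<ge> 2" "n = 2 * k + b" using a by (auto simp: b_def N_def)
      obtain l where l: "n div b = 2 * l + 1" using a unfolding b_def[symmetric] by (elim oddE)
      have n: "n = b * (2 * l + 1)" using a l unfolding b_def[symmetric] by (metis dvd_mult_div_cancel)
      have "k = b * l" using n b by (simp add: algebra_simps)
      moreover have "n div (2 * l + 1) = b" unfolding n by (rule nonzero_mult_div_cancel_right) simp
      moreover have "(2 * l + 1) dvd n" unfolding n by (rule dvd_triv_right)
      moreover have "n \<noteq> 2 * l + 1"
      proof
        assume "n = 2 * l + 1"
        then have "b * (2 * l + 1) = 1 * (2 * l + 1)" using n by simp
        then show False using b(1) by (simp only: mult_cancel2) simp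
      qed
      ultimately show ?thesis 
        unfolding \<rho>_def \<kappa>_def b_def[symmetric] l by simp
    qed
    show ?thesis
      unfolding \<kappa>_def[symmetric]
    proof (rule sum.reindex_bij_witness[where i = \<kappa> and j = \<rho>])
      fix a assume "a \<in> {k. k < N \<and> (n - 2 * k) dvd n \<and> odd (n div (n - 2 * k))}"
      then have a: "\<rho> a \<noteq> n \<and> \<rho> a dvd n \<and> odd (\<rho> a) \<and> \<kappa> (\<rho> a) = a \<and> n div \<rho> a = n - 2 * a"
        using k by blast
      then show "\<kappa> (\<rho> a) = a" "\<rho> a \<in> {r. r dvd n \<and> odd r \<and> r \<noteq> n}"
        "real (n div \<rho> a) * q ^ \<kappa> (\<rho> a) * (1 - q) = real (n - 2 * a) * q ^ a * (1 - q)"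
        by simp_all
    next
      fix b assume "b \<in> {r. r dvd n \<and> odd r \<and> r \<noteq> n}"
      then have b: "odd b" "n - 2 * \<kappa> b = n div b \<and> n div b dvd n \<and> \<kappa> b < N \<and> \<rho> (\<kappa> b) = b"
        using r by auto
      moreover have "n div (n - 2 * \<kappa> b) = b" using b unfolding \<rho>_def by metis
      moreover have "(n - 2 * \<kappa> b) dvd n" using b by metis
      ultimately show "\<rho> (\<kappa> b) = b" "\<kappa> b \<in> {k. k < N \<and> (n - 2 * k) dvd n \<and> odd (n div (n - 2 * k))}"
        by simp_all
    qed
  qed
  finally show ?thesis by (simp add: N_def)
qed

end
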